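(* Let $n\ge 1$. The poset $(\mathsf{Div}(\Delta_n),\leq)$ is a lattice. Moreover, for each $i\in\{0,1,\dots,n+1\}$ the restriction of $\leq$ to $D_n^i$ is itself a lattice, with join and meet denoted $\vee_i$ and $\wedge_i$ respectively, and given $i,j\in\{0,1,\dots,n+1\}$ with $i\le j$ and $x\in D_n^i$, $y\in D_n^j$, the meet of $x$ and $y$ in $(\mathsf{Div}(\Delta_n),\leq)$ is $$x\wedge y = x\wedge_i\Big(\bigvee\nolimits_i\{z\in D_n^i \mid z\le y\}\Big).$$ (If $i=j$ this is simply $x\wedge y=x\wedge_i y$.)
   Context: For $n\ge 1$, let $M_n$ be the monoid with presentation $\langle \rho_1,\dots,\rho_n \mid \rho_1\rho_n\rho_i=\rho_{i+1}\rho_n \text{ for all } 1\le i\le n-1\rangle$. For $a,b\in M_n$ write $a\le b$ ($a$ left-divides $b$) if there is $c\in M_n$ with $ac=b$; this is a partial order on $M_n$, and $M_n$ is left- and right-cancellative. Let $\Delta_n:=\rho_n^{n+1}$, and let $\mathsf{Div}(\Delta_n)$ be the (finite) set of left divisors of $\Delta_n$ in $M_n$; it coincides with the set of right divisors of $\Delta_n$. For $x\in \mathsf{Div}(\Delta_n)$ let $d(x):=\max\{k\ge 0\mid \rho_n^k\le x\}$, and for $0\le i\le n+1$ let $D_n^i:=\{x\in\mathsf{Div}(\Delta_n)\mid d(x)=i\}$, so that $\mathsf{Div}(\Delta_n)$ is the disjoint union of the $D_n^i$. *)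

theory Defs
  imports "HOL-Algebra.Divisibility"
begin

section \<open>Monoids given by a presentation\<close>

text \<open>The congruence on the free monoid \<^term>\<open>lists A\<close> generated by a set \<open>R\<close> of pairs of words.\<close>

inductive_set pres_cong :: "'a set \<Rightarrow> ('a list \<times> 'a list) set \<Rightarrow> ('a list \<times> 'a list) set"
  for A :: "'a set" and R :: "('a list \<times> 'a list) set" where
  base: "(u, v) \<in> R \<Longrightarrow> u \<in> lists A \<Longrightarrow> v \<in> lists A \<Longrightarrow> (u, v) \<in> pres_cong A R"
| refl: "u \<in> lists A \<Longrightarrow> (u, u) \<in> pres_cong A R"
| sym: "(u, v) \<in> pres_cong A R \<Longrightarrow> (v, u) \<in> pres_cong A R"
| trans: "(u, v) \<in> pres_cong A R \<Longrightarrow> (v, w) \<in> pres_cong A R \<Longrightarrow> (u, w) \<in> pres_cong A R"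
| append: "(u, u') \<in> pres_cong A R \<Longrightarrow> (v, v') \<in> pres_cong A R
    \<Longrightarrow> (u @ v, u' @ v') \<in> pres_cong A R"

definition pres_monoid :: "'a set \<Rightarrow> ('a list \<times> 'a list) set \<Rightarrow> 'a list set monoid" where
  "pres_monoid A R = \<lparr>carrier = lists A // pres_cong A R,
     monoid.mult = (\<lambda>X Y. \<Union>u\<in>X. \<Union>v\<in>Y. pres_cong A R `` {u @ v}),
     one = pres_cong A R `` {[]}\<rparr>"

lemma pres_cong_subset: "pres_cong A R \<subseteq> lists A \<times> lists A"
proof (rule subrelI)
  fix u v assume "(u, v) \<in> pres_cong A R"
  then show "(u, v) \<in> lists A \<times> lists A"
    by induction auto
qed

lemma equiv_pres_cong: "equiv (lists A) (pres_cong A R)"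
  using pres_cong_subset[of A R]
  by (intro equivI refl_onI symI transI) (auto intro: pres_cong.intros)

lemma pres_monoid_mult_class:
  assumes "u \<in> lists A" "v \<in> lists A"
  shows "pres_cong A R `` {u} \<otimes>\<^bsub>pres_monoid A R\<^esub> pres_cong A R `` {v} = pres_cong A R `` {u @ v}"
proof -
  have "congruent2 (pres_cong A R) (pres_cong A R) (\<lambda>u v. pres_cong A R `` {u @ v})"
    by (intro congruent2I' equiv_class_eq[OF equiv_pres_cong] pres_cong.append)
  then show ?thesis
    using UN_equiv_class2[OF equiv_pres_cong equiv_pres_cong _ assms]
    by (simp add: pres_monoid_def)
qed

lemma monoid_pres_monoid: "monoid (pres_monoid A R)"
proof -
  let ?c = "\<lambda>u. pres_cong A R `` {u}"
  have carrier: "carrier (pres_monoid A R) = ?c ` lists A"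
    by (auto simp: pres_monoid_def quotient_def)
  have one: "\<one>\<^bsub>pres_monoid A R\<^esub> = ?c []"
    by (simp add: pres_monoid_def)
  have words: "[] \<in> lists A" "\<And>u v. u \<in> lists A \<Longrightarrow> v \<in> lists A \<Longrightarrow> u @ v \<in> lists A"
    by simp_all
  note simps = pres_monoid_mult_class words append_assoc append_Nil append_Nil2
  show ?thesis
  proof (rule monoidI, unfold carrier one)
    show "?c [] \<in> ?c ` lists A"
      using words(1) by (rule imageI)
  next
    fix x y assume "x \<in> ?c ` lists A" "y \<in> ?c ` lists A"
    then show "x \<otimes>\<^bsub>pres_monoid A R\<^esub> y \<in> ?c ` lists A"
      by (elim imageE) (simp only: simps, intro imageI words)
  next
    fix x y z assume "x \<in> ?c ` lists A" "y \<in> ?c ` lists A" "z \<in> ?c ` lists A"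
    then show "x \<otimes>\<^bsub>pres_monoid A R\<^esub> y \<otimes>\<^bsub>pres_monoid A R\<^esub> z
        = x \<otimes>\<^bsub>pres_monoid A R\<^esub> (y \<otimes>\<^bsub>pres_monoid A R\<^esub> z)"
      by (elim imageE) (simp only: simps)
  next
    fix x assume "x \<in> ?c ` lists A"
    then show "?c [] \<otimes>\<^bsub>pres_monoid A R\<^esub> x = x"
      by (elim imageE) (simp only: simps)
  next
    fix x assume "x \<in> ?c ` lists A"
    then show "x \<otimes>\<^bsub>pres_monoid A R\<^esub> ?c [] = x"
      by (elim imageE) (simp only: simps)
  qed
qed

section \<open>The monoid and the divisors of its element \<open>\<Delta>\<close>\<close>

text \<open>The word \<open>[i\<^sub>1, \<dots>, i\<^sub>k]\<close> stands for the product \<open>\<rho>\<^sub>i\<^sub>1 \<cdots> \<rho>\<^sub>i\<^sub>k\<close>.\<close>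

definition M_rels :: "nat \<Rightarrow> (nat list \<times> nat list) set" where
  "M_rels n = {([1, n, i], [i + 1, n]) | i. 1 \<le> i \<and> i < n}"

definition M :: "nat \<Rightarrow> nat list set monoid" where
  "M n = pres_monoid {1..n} (M_rels n)"

definition \<rho> :: "nat \<Rightarrow> nat \<Rightarrow> nat list set" where
  "\<rho> n i = pres_cong {1..n} (M_rels n) `` {[i]}"

definition \<Delta> :: "nat \<Rightarrow> nat list set" where
  "\<Delta> n = \<rho> n n [^]\<^bsub>M n\<^esub> (n + 1)"

text \<open>The library relation \<^term>\<open>a divides\<^bsub>G\<^esub> b\<close> is left divisibility: \<open>b = a c\<close> for some \<open>c\<close>
  in the carrier of \<open>G\<close>.\<close>

definition Div\<Delta> :: "nat \<Rightarrow> nat list set set" where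
  "Div\<Delta> n = {x \<in> carrier (M n). x divides\<^bsub>M n\<^esub> \<Delta> n}"

text \<open>The relations are homogeneous when \<open>\<rho>\<^sub>i\<close> has weight \<open>i\<close>, so for \<open>n \<ge> 1\<close> the set below is finite and
  its \<^const>\<open>Max\<close> is a genuine maximum.\<close>

definition d :: "nat \<Rightarrow> nat list set \<Rightarrow> nat" where
  "d n x = Max {k. \<rho> n n [^]\<^bsub>M n\<^esub> k divides\<^bsub>M n\<^esub> x}"

definition D :: "nat \<Rightarrow> nat \<Rightarrow> nat list set set" where
  "D n i = {x \<in> Div\<Delta> n. d n x = i}"

text \<open>A subset \<open>X\<close> of the monoid ordered by left divisibility; the quotients witnessing
  divisibility range over the whole monoid, not only over \<open>X\<close>.\<close>

definition div_poset :: "nat \<Rightarrow> nat list set set \<Rightarrow> nat list set gorder" where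
  "div_poset n X = \<lparr>carrier = X, eq = (=), le = (\<lambda>x y. x divides\<^bsub>M n\<^esub> y)\<rparr>"

abbreviation Div_poset :: "nat \<Rightarrow> nat list set gorder" where
  "Div_poset n \<equiv> div_poset n (Div\<Delta> n)"

abbreviation D_poset :: "nat \<Rightarrow> nat \<Rightarrow> nat list set gorder" where
  "D_poset n i \<equiv> div_poset n (D n i)"

end

theory Submission
  imports Defs
begin

text \<open>The relations imply \<open>\<rho>\<^sub>j \<rho>\<^sub>n\<^sup>j \<rho>\<^sub>k\<^sub>-\<^sub>j = \<rho>\<^sub>k \<rho>\<^sub>n\<^sup>j\<close> for \<open>j < k\<close>. By induction on the weight
  (\<open>\<rho>\<^sub>i\<close> having weight \<open>i\<close>), as in Garside's treatment of braid monoids, \<open>\<rho>\<^sub>j X = \<rho>\<^sub>k Y\<close> forces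
  \<open>X = \<rho>\<^sub>n\<^sup>j \<rho>\<^sub>k\<^sub>-\<^sub>j W\<close> and \<open>Y = \<rho>\<^sub>n\<^sup>j W\<close>. Hence the monoid is left cancellative, and two elements
  with a common right multiple have a least one; this makes the divisors of \<open>\<Delta>\<close> a lattice.

  Put \<open>\<tau> = \<rho>\<^sub>1 \<rho>\<^sub>n\<close>. Then \<open>\<tau>\<^sup>n = \<Delta>\<close> is central, and whenever \<open>s t = \<Delta>\<close>, either \<open>\<rho>\<^sub>n\<close> divides \<open>t\<close> on the
  left or \<open>\<tau>\<close> divides \<open>s\<close> on the right: this property of a word for \<open>\<Delta>\<close>, for all its splittings, is
  unchanged by applying a relation. It follows that a divisor of \<open>\<Delta>\<close> not divisible by \<open>\<rho>\<^sub>n\<close> divides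
  \<open>\<tau>\<^sup>n\<^sup>-\<^sup>1\<close>, which is itself not divisible by \<open>\<rho>\<^sub>n\<close>. Therefore each \<open>D\<^sub>n\<^sup>i\<close> is closed under least common
  multiples as well as under meets with elements of \<open>D\<^sub>n\<^sup>j\<close>, \<open>j \<ge> i\<close>, so the elements of \<open>D\<^sub>n\<^sup>i\<close> below
  \<open>y\<close> have a maximum and the formula for the meet follows.\<close>

section \<open>Common multiples of generators\<close>

abbreviation cong_word :: "nat \<Rightarrow> nat list \<Rightarrow> nat list \<Rightarrow> bool" where
  "cong_word n u v \<equiv> (u, v) \<in> pres_cong {1..n} (M_rels n)"

lemma cong_word_lists: "cong_word n u v \<Longrightarrow> u \<in> lists {1..n} \<and> v \<in> lists {1..n}"
  using pres_cong_subset by blast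

lemma cong_word_append_left: "w \<in> lists {1..n} \<Longrightarrow> cong_word n u v \<Longrightarrow> cong_word n (w @ u) (w @ v)"
  by (intro pres_cong.append pres_cong.refl)

lemma cong_word_append_right: "w \<in> lists {1..n} \<Longrightarrow> cong_word n u v \<Longrightarrow> cong_word n (u @ w) (v @ w)"
  by (intro pres_cong.append pres_cong.refl)

lemma cong_word_sum_list: "cong_word n u v \<Longrightarrow> sum_list u = sum_list v"
  by (induction rule: pres_cong.induct) (auto simp: M_rels_def)

lemma replicate_in_lists: "(n::nat) \<ge> 1 \<Longrightarrow> replicate k n \<in> lists {1..n}"
  by (auto simp: in_lists_conv_set)

text \<open>Induction on \<open>j\<close> for all \<open>k\<close>: the defining relation turns
  \<open>[j + 1, n]\<close> into \<open>[1, n, j]\<close>, the case of \<open>j\<close> and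
  \<open>k - 1\<close> applies behind \<open>[1, n]\<close>, and the relation for
  \<open>k - 1\<close> closes up the front again.\<close>

lemma lcm_relation:
  assumes "1 \<le> j" "j < k" "k \<le> n"
  shows "cong_word n (j # replicate j n @ [k - j]) (k # replicate j n)"
  using assms
proof (induction j arbitrary: k rule: nat_induct_at_least)
  case base
  then have "([1, n, k - 1], [(k - 1) + 1, n]) \<in> M_rels n"
    unfolding M_rels_def by (intro CollectI exI[of _ "k - 1"]) auto
  with base show ?case
    by (intro pres_cong.base) auto
next
  case (Suc j)
  have rep: "replicate m n \<in> lists {1..n}" for m
    using Suc by (intro replicate_in_lists) auto
  have step: "cong_word n [i + 1, n] [1, n, i]" if "1 \<le> i" "i < n" for i
    using that by (intro pres_cong.sym[OF pres_cong.base]) (auto simp: M_rels_def)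
  have "cong_word n ([j + 1, n] @ (replicate j n @ [k - Suc j])) ([1, n, j] @ (replicate j n @ [k - Suc j]))"
    using Suc rep by (intro cong_word_append_right step) auto
  then have 1: "cong_word n (Suc j # replicate (Suc j) n @ [k - Suc j]) ([1, n] @ j # replicate j n @ [k - 1 - j])"
    by simp
  have 2: "cong_word n ([1, n] @ j # replicate j n @ [k - 1 - j]) ([1, n] @ (k - 1) # replicate j n)"
    using Suc by (intro cong_word_append_left Suc.IH) auto
  have "cong_word n ([1, n, k - 1] @ replicate j n) ([k - 1 + 1, n] @ replicate j n)"
    using Suc rep by (intro cong_word_append_right pres_cong.sym[OF step]) auto
  then have 3: "cong_word n ([1, n] @ (k - 1) # replicate j n) (k # replicate (Suc j) n)"
    using Suc.prems by simp
  show ?case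
    using pres_cong.trans[OF pres_cong.trans[OF 1 2] 3] .
qed

section \<open>Residuals of congruent words after their first letters\<close>

definition residual_less :: "nat \<Rightarrow> nat \<Rightarrow> nat list \<Rightarrow> nat \<Rightarrow> nat list \<Rightarrow> bool" where
  "residual_less n a X b Y \<longleftrightarrow> a < b \<and>
     (\<exists>W. cong_word n X (replicate a n @ [b - a] @ W) \<and> cong_word n Y (replicate a n @ W))"

text \<open>By \<open>lcm_relation\<close>, \<open>residual_less\<close> makes \<open>a # X\<close>
  and \<open>b # Y\<close> both congruent to \<open>b # replicate a n\<close> followed by the same
  \<open>W\<close>. So for letters in range \<open>residual\<close> is sufficient for congruence;
  its necessity is what the induction on weight establishes.\<close>

definition residual :: "nat \<Rightarrow> nat \<Rightarrow> nat list \<Rightarrow> nat \<Rightarrow> nat list \<Rightarrow> bool" where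
  "residual n a X b Y \<longleftrightarrow>
     a = b \<and> cong_word n X Y \<or> residual_less n a X b Y \<or> residual_less n b Y a X"

definition word_residual :: "nat \<Rightarrow> nat list \<Rightarrow> nat list \<Rightarrow> bool" where
  "word_residual n u v \<longleftrightarrow>
     u = [] \<and> v = [] \<or> (\<exists>a X b Y. u = a # X \<and> v = b # Y \<and> residual n a X b Y)"

lemma residual_sym: "residual n a X b Y \<Longrightarrow> residual n b Y a X"
  unfolding residual_def by (blast intro: pres_cong.sym)

lemma word_residual_Cons [simp]: "word_residual n (a # X) (b # Y) \<longleftrightarrow> residual n a X b Y"
  by (auto simp: word_residual_def)

lemma residual_cong:
  assumes "residual n a X b Y" "cong_word n X' X" "cong_word n Y' Y"
  shows "residual n a X' b Y'"
proof -
  note trs = pres_cong.trans[OF assms(2)] pres_cong.trans[OF assms(3)]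
  have "cong_word n X' Y'" if "cong_word n X Y"
    using trs(1)[OF pres_cong.trans[OF that pres_cong.sym[OF assms(3)]]] .
  moreover have "residual_less n a X' b Y'" if "residual_less n a X b Y"
    using that trs unfolding residual_less_def by blast
  moreover have "residual_less n b Y' a X'" if "residual_less n b Y a X"
    using that trs unfolding residual_less_def by blast
  ultimately show ?thesis
    using assms(1) unfolding residual_def by blast
qed

lemma residual_refl:
  assumes "residual n a X b Y"
  shows "cong_word n X X" "cong_word n Y Y"
proof -
  have "X \<in> lists {1..n} \<and> Y \<in> lists {1..n}"
    using assms cong_word_lists unfolding residual_def residual_less_def by blast
  then show "cong_word n X X" "cong_word n Y Y"
    by (auto intro: pres_cong.refl)
qed

lemma residual_append:
  assumes "residual n a X b Y" "cong_word n v v'"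
  shows "residual n a (X @ v) b (Y @ v')"
proof -
  have less: "residual_less n a (X @ v) b (Y @ v')"
    if l: "residual_less n a X b Y" and c: "cong_word n v v'" for a X b Y v v'
  proof -
    obtain W where W: "a < b" "cong_word n X (replicate a n @ [b - a] @ W)" "cong_word n Y (replicate a n @ W)"
      using l by (auto simp: residual_less_def)
    have "cong_word n (Y @ v') (replicate a n @ W @ v)"
      using pres_cong.append[OF W(3) pres_cong.sym[OF c]] by simp
    moreover have "cong_word n (X @ v) (replicate a n @ [b - a] @ W @ v)"
      using pres_cong.append[OF W(2) pres_cong.refl[of v]] cong_word_lists[OF c] by simp
    ultimately show ?thesis
      using W(1) unfolding residual_less_def by blast
  qed
  show ?thesis
    using assms less less[OF _ pres_cong.sym[OF assms(2)]] unfolding residual_def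
    by (auto intro: pres_cong.append)
qed

section \<open>Transitivity of residuals, with \<open>smaller\<close> as the hypothesis of an
  induction on weight\<close>

context
  fixes n w :: nat
  assumes smaller: "\<And>u v. cong_word n u v \<Longrightarrow> sum_list u < w \<Longrightarrow> word_residual n u v"
begin

text \<open>For equal first letters \<open>residual\<close> is just congruence of the tails, so
  \<open>smaller\<close> removes \<open>p\<close> letter by letter.\<close>

lemma cancel_smaller:
  assumes "cong_word n (p @ u) (p @ v)" "sum_list (p @ u) < w"
  shows "cong_word n u v"
  using assms
proof (induction p)
  case (Cons a p)
  then have "residual n a (p @ u) a (p @ v)"
    using smaller[of "a # p @ u" "a # p @ v"] by simp
  then have "cong_word n (p @ u) (p @ v)"
    by (auto simp: residual_def residual_less_def)
  with Cons show ?case by simp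
qed simp

text \<open>This is the compatibility of the common multiples of three generators, checked by the
  position of \<open>b\<close> relative to \<open>a < c\<close>. The hypothesis
  \<open>smaller\<close> is only applied to words congruent to \<open>Y\<close> or to suffixes of
  them, hence the bound on the weight of \<open>Y\<close> alone.\<close>

lemma residual_trans_less:
  assumes ab: "residual n a X b Y" and bc: "residual n b Y c Z"
    and wt: "sum_list Y < w" and ac: "a < c"
    and abc: "a \<in> {1..n}" "b \<in> {1..n}" "c \<in> {1..n}"
  shows "residual n a X c Z"
proof -
  let ?r = "\<lambda>k. replicate k n"
  have rep: "?r k \<in> lists {1..n}" for k
    using abc by (intro replicate_in_lists) auto
  have shape: "residual n a X c Z"
    if "cong_word n X (?r a @ [c - a] @ W)" "cong_word n Z (?r a @ W)" for W
    using that ac unfolding residual_def residual_less_def by blast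
  note trs = pres_cong.trans and sm = pres_cong.sym
  consider "a = b" | "b = c" | "c < b" | "a < b" "b < c" | "b < a"
    using ac by linarith
  then show ?thesis
  proof cases
    case 1
    with ab have "cong_word n X Y" by (auto simp: residual_def residual_less_def)
    then show ?thesis
      using residual_cong[OF bc _ residual_refl(2)[OF bc]] 1 by blast
  next
    case 2
    with bc have "cong_word n Y Z" by (auto simp: residual_def residual_less_def)
    then show ?thesis
      using residual_cong[OF ab residual_refl(1)[OF ab] sm] 2 by blast
  next
    case 3
    with ab ac obtain W where W: "cong_word n X (?r a @ [b - a] @ W)" "cong_word n Y (?r a @ W)"
      by (auto simp: residual_def residual_less_def)
    from 3 bc obtain V where V: "cong_word n Z (?r c @ [b - c] @ V)" "cong_word n Y (?r c @ V)"
      by (auto simp: residual_def residual_less_def)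
    have rc: "?r c = ?r a @ ?r (c - a)"
      using ac by (metis less_imp_add_positive replicate_add add_diff_cancel_left')
    have Vl: "V \<in> lists {1..n}" using cong_word_lists[OF V(2)] by simp
    have "cong_word n (?r a @ W) (?r a @ ?r (c - a) @ V)"
      using trs[OF sm[OF W(2)] V(2)] rc by simp
    then have WV: "cong_word n W (?r (c - a) @ V)"
      by (rule cancel_smaller[of "?r a"])
         (use wt cong_word_sum_list[OF W(2)] in auto)
    have "cong_word n ((?r a @ [b - a]) @ W) ((?r a @ [b - a]) @ ?r (c - a) @ V)"
      using WV cong_word_lists[OF W(1)] by (intro cong_word_append_left) auto
    then have X: "cong_word n X (?r a @ [b - a] @ ?r (c - a) @ V)"
      using trs[OF W(1)] by simp
    \<comment> \<open>\<open>lcm_relation\<close> for \<open>c - a < b - a\<close>, read from right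
      to left, exchanges the letter \<open>b - a\<close> in \<open>X\<close> for the required
      \<open>c - a\<close>.\<close>
    have "(b - a) - (c - a) = b - c"
      using ac 3 by simp
    moreover have "cong_word n (?r a @ (((c - a) # ?r (c - a) @ [(b - a) - (c - a)]) @ V))
        (?r a @ (((b - a) # ?r (c - a)) @ V))"
      using 3 ac abc rep Vl
      by (intro cong_word_append_left cong_word_append_right lcm_relation) auto
    ultimately have "cong_word n (?r a @ [c - a] @ ?r (c - a) @ [b - c] @ V) (?r a @ [b - a] @ ?r (c - a) @ V)"
      by simp
    from trs[OF X sm[OF this]]
    have "cong_word n X (?r a @ [c - a] @ ?r (c - a) @ [b - c] @ V)" .
    then show ?thesis
      using V(1) rc by (intro shape[of "?r (c - a) @ [b - c] @ V"]) auto
  next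
    case 4
    from 4 ab obtain W where W: "cong_word n X (?r a @ [b - a] @ W)" "cong_word n Y (?r a @ W)"
      by (auto simp: residual_def residual_less_def)
    from 4 bc obtain V where V: "cong_word n Y (?r b @ [c - b] @ V)" "cong_word n Z (?r b @ V)"
      by (auto simp: residual_def residual_less_def)
    have rb: "?r b = ?r a @ ?r (b - a)"
      using 4 by (metis less_imp_add_positive replicate_add add_diff_cancel_left')
    have Vl: "V \<in> lists {1..n}" using cong_word_lists[OF V(2)] by simp
    have "cong_word n (?r a @ W) (?r a @ ?r (b - a) @ [c - b] @ V)"
      using trs[OF sm[OF W(2)] V(1)] rb by simp
    then have WV: "cong_word n W (?r (b - a) @ [c - b] @ V)"
      by (rule cancel_smaller[of "?r a"])
         (use wt cong_word_sum_list[OF W(2)] in auto)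
    have "cong_word n ((?r a @ [b - a]) @ W) ((?r a @ [b - a]) @ ?r (b - a) @ [c - b] @ V)"
      using WV cong_word_lists[OF W(1)] by (intro cong_word_append_left) auto
    then have X: "cong_word n X (?r a @ [b - a] @ ?r (b - a) @ [c - b] @ V)"
      using trs[OF W(1)] by simp
    \<comment> \<open>Here the relation is the one for \<open>b - a < c - a\<close>, read from left
      to right.\<close>
    have "(c - a) - (b - a) = c - b"
      using 4 by simp
    moreover have "cong_word n (?r a @ (((b - a) # ?r (b - a) @ [(c - a) - (b - a)]) @ V))
        (?r a @ (((c - a) # ?r (b - a)) @ V))"
      using 4 abc rep Vl
      by (intro cong_word_append_left cong_word_append_right lcm_relation) auto
    ultimately have "cong_word n (?r a @ [b - a] @ ?r (b - a) @ [c - b] @ V) (?r a @ [c - a] @ ?r (b - a) @ V)"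
      by simp
    from trs[OF X this]
    have "cong_word n X (?r a @ [c - a] @ ?r (b - a) @ V)" .
    then show ?thesis
      using V(2) rb by (intro shape[of "?r (b - a) @ V"]) auto
  next
    case 5
    from 5 ab obtain W where W: "cong_word n Y (?r b @ [a - b] @ W)" "cong_word n X (?r b @ W)"
      by (auto simp: residual_def residual_less_def)
    from 5 ac bc obtain V where V: "cong_word n Y (?r b @ [c - b] @ V)" "cong_word n Z (?r b @ V)"
      by (auto simp: residual_def residual_less_def)
    have ra: "?r a = ?r b @ ?r (a - b)"
      using 5 by (metis less_imp_add_positive replicate_add add_diff_cancel_left')
    have "cong_word n (?r b @ [a - b] @ W) (?r b @ [c - b] @ V)"
      using trs[OF sm[OF W(1)] V(1)] .
    then have "cong_word n ([a - b] @ W) ([c - b] @ V)"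
      by (rule cancel_smaller[of "?r b"])
         (use wt cong_word_sum_list[OF W(1)] in auto)
    \<comment> \<open>Two different letters now start congruent words of weight below
      \<open>w\<close>, so the induction hypothesis yields a common tail \<open>U\<close>.\<close>
    then have "residual n (a - b) W (c - b) V"
      using smaller[of "(a - b) # W" "(c - b) # V"] wt cong_word_sum_list[OF W(1)] by simp
    then obtain U where U: "cong_word n W (?r (a - b) @ [c - a] @ U)" "cong_word n V (?r (a - b) @ U)"
      using ac 5 by (auto simp: residual_def residual_less_def)
    show ?thesis
    proof (rule shape)
      show "cong_word n X (?r a @ [c - a] @ U)"
        using trs[OF W(2) cong_word_append_left[OF rep U(1)]] ra by simp
      show "cong_word n Z (?r a @ U)"
        using trs[OF V(2) cong_word_append_left[OF rep U(2)]] ra by simp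
    qed
  qed
qed

text \<open>The case \<open>c < a\<close> follows by symmetry. For \<open>a = c\<close>, both
  residuals against \<open>b\<close> describe \<open>Y\<close> with the same prefix, which
  cancels.\<close>

lemma residual_trans:
  assumes ab: "residual n a X b Y" and bc: "residual n b Y c Z"
    and wt: "sum_list Y < w"
    and abc: "a \<in> {1..n}" "b \<in> {1..n}" "c \<in> {1..n}"
  shows "residual n a X c Z"
proof -
  consider "a < c" | "c < a" | "a = c" by linarith
  then show ?thesis
  proof cases
    case 1
    then show ?thesis using residual_trans_less assms by blast
  next
    case 2
    then show ?thesis
      using residual_sym[OF residual_trans_less[OF residual_sym[OF bc] residual_sym[OF ab] wt]] abc
      by blast
  next
    case 3
    note trs = pres_cong.trans and sm = pres_cong.sym
    have rep: "replicate k n \<in> lists {1..n}" for k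
      using abc by (intro replicate_in_lists) auto
    consider "a = b" | "a < b" | "b < a" by linarith
    then have "cong_word n X Z"
    proof cases
      case 1
      with 3 ab bc have "cong_word n X Y" "cong_word n Y Z"
        by (auto simp: residual_def residual_less_def)
      then show ?thesis by (rule trs)
    next
      case 2
      with ab obtain W where W: "cong_word n X (replicate a n @ [b - a] @ W)" "cong_word n Y (replicate a n @ W)"
        by (auto simp: residual_def residual_less_def)
      from 2 3 bc obtain V where V: "cong_word n Z (replicate a n @ [b - a] @ V)" "cong_word n Y (replicate a n @ V)"
        by (auto simp: residual_def residual_less_def)
      have "cong_word n W V"
        by (rule cancel_smaller[of "replicate a n"])
         (use trs[OF sm[OF W(2)] V(2)] wt cong_word_sum_list[OF W(2)] in auto)
      then have "cong_word n ((replicate a n @ [b - a]) @ W) ((replicate a n @ [b - a]) @ V)"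
        using cong_word_lists[OF W(1)] by (intro cong_word_append_left) auto
      then show ?thesis using trs[OF trs[OF W(1)] sm[OF V(1)]] by simp
    next
      case r: 3
      with ab obtain W where W: "cong_word n Y (replicate b n @ [a - b] @ W)" "cong_word n X (replicate b n @ W)"
        by (auto simp: residual_def residual_less_def)
      from 3 r bc obtain V where V: "cong_word n Y (replicate b n @ [a - b] @ V)" "cong_word n Z (replicate b n @ V)"
        by (auto simp: residual_def residual_less_def)
      have "cong_word n W V"
        by (rule cancel_smaller[of "replicate b n @ [a - b]"])
         (use trs[OF sm[OF W(1)] V(1)] wt cong_word_sum_list[OF W(1)] in auto)
      then have "cong_word n (replicate b n @ W) (replicate b n @ V)"
        using rep by (intro cong_word_append_left) auto
      then show ?thesis using trs[OF trs[OF W(2)] sm[OF V(2)]] by simp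
    qed
    then show ?thesis using 3 by (simp add: residual_def)
  qed
qed

text \<open>The congruence preserves weight, so an induction on its derivation never leaves the
  words of weight at most \<open>w\<close>.\<close>

lemma word_residual_step:
  assumes "cong_word n u v" "sum_list u \<le> w"
  shows "word_residual n u v"
  using assms
proof (induction rule: pres_cong.induct)
  case (base u v)
  then obtain i where i: "u = [1, n, i]" "v = [i + 1, n]" "1 \<le> i" "i < n"
    by (auto simp: M_rels_def)
  then have "residual_less n 1 [n, i] (i + 1) [n]"
    unfolding residual_less_def by (auto intro!: exI[of _ "[]"] pres_cong.refl)
  with i show ?case by (auto simp: residual_def)
next
  case (refl u)
  then show ?case
    by (cases u) (auto simp: word_residual_def residual_def intro: pres_cong.refl)
next
  case (sym u v)
  then have "word_residual n u v"
    using cong_word_sum_list by force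
  then consider "u = []" "v = []" | a X b Y where "u = a # X" "v = b # Y" "residual n a X b Y"
    unfolding word_residual_def by blast
  then show ?case
    by cases (auto simp: word_residual_def intro: residual_sym)
next
  case (trans u v v')
  then have r: "word_residual n u v" "word_residual n v v'"
    using cong_word_sum_list[OF trans.hyps(1)] by auto
  show ?case
  proof (cases v)
    case Nil
    with r show ?thesis by (auto simp: word_residual_def)
  next
    case (Cons b Y)
    with r obtain a X c Z where e: "u = a # X" "v' = c # Z" "residual n a X b Y" "residual n b Y c Z"
      by (auto simp: word_residual_def)
    have "a \<in> {1..n}" "b \<in> {1..n}" "c \<in> {1..n}"
      using e Cons cong_word_lists[OF trans.hyps(1)] cong_word_lists[OF trans.hyps(2)] by auto
    \<comment> \<open>The first letter \<open>b\<close> is at least \<open>1\<close>, so dropping it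
      brings the weight strictly below \<open>w\<close>.\<close>
    moreover from this have "sum_list Y < w"
      using cong_word_sum_list[OF trans.hyps(1)] trans.prems Cons by simp
    ultimately show ?thesis using residual_trans e by simp
  qed
next
  case (append u u' v v')
  then have r: "word_residual n u u'" "word_residual n v v'" by auto
  from r(1) consider "u = []" "u' = []" | a X b Y where "u = a # X" "u' = b # Y" "residual n a X b Y"
    unfolding word_residual_def by blast
  then show ?case
  proof cases
    case 1
    then show ?thesis using r(2) by simp
  next
    case 2
    then show ?thesis using residual_append[OF _ append.hyps(2)] by simp
  qed
qed

end

lemma cong_word_imp_word_residual: "cong_word n u v \<Longrightarrow> word_residual n u v"
proof (induction "sum_list u" arbitrary: u v rule: less_induct)
  case less
  show ?case
    by (rule word_residual_step[where w = "sum_list u"]) (use less in auto)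
qed

lemma cong_word_cancel:
  assumes "cong_word n (p @ u) (p @ v)"
  shows "cong_word n u v"
proof (rule cancel_smaller[where w = "Suc (sum_list (p @ u))" and p = p])
  show "word_residual n u v" if "cong_word n u v" for u v
    using that by (rule cong_word_imp_word_residual)
  show "sum_list (p @ u) < Suc (sum_list (p @ u))" by simp
qed (rule assms)

section \<open>Divisor lattices in graded monoids with least common multiples\<close>

text \<open>Existence of lcms is assumed for pairs of atoms only and extended to all pairs with a
  common multiple. The weight makes divisibility antisymmetric and carries the inductions.\<close>

locale lcm_monoid = monoid G for G (structure) +
  fixes wt :: "'a \<Rightarrow> nat" and A :: "'a set"
  assumes atoms_closed: "a \<in> A \<Longrightarrow> a \<in> carrier G"
    and left_cancel: "\<lbrakk>c \<otimes> x = c \<otimes> y; c \<in> carrier G; x \<in> carrier G; y \<in> carrier G\<rbrakk> \<Longrightarrow> x = y"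
    and wt_mult: "\<lbrakk>x \<in> carrier G; y \<in> carrier G\<rbrakk> \<Longrightarrow> wt (x \<otimes> y) = wt x + wt y"
    and wt_eq_0: "\<lbrakk>x \<in> carrier G; wt x = 0\<rbrakk> \<Longrightarrow> x = \<one>"
    and wt_atom: "a \<in> A \<Longrightarrow> wt a > 0"
    and atom_factor: "\<lbrakk>x \<in> carrier G; x \<noteq> \<one>\<rbrakk> \<Longrightarrow> \<exists>a\<in>A. \<exists>y\<in>carrier G. x = a \<otimes> y"
    and atom_lcm: "\<lbrakk>a \<in> A; b \<in> A; m \<in> carrier G; a divides m; b divides m\<rbrakk> \<Longrightarrow>
      \<exists>l\<in>carrier G. a divides l \<and> b divides l \<and>
        (\<forall>c\<in>carrier G. a divides c \<longrightarrow> b divides c \<longrightarrow> l divides c)"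
begin

section \<open>Least common multiples of arbitrary elements\<close>

definition is_lcm :: "'a \<Rightarrow> 'a \<Rightarrow> 'a \<Rightarrow> bool" where
  "is_lcm x y l \<longleftrightarrow> l \<in> carrier G \<and> x divides l \<and> y divides l \<and>
     (\<forall>c\<in>carrier G. x divides c \<longrightarrow> y divides c \<longrightarrow> l divides c)"

lemma is_lcmD:
  assumes "is_lcm x y l"
  shows "l \<in> carrier G" "x divides l" "y divides l"
    "\<And>c. \<lbrakk>c \<in> carrier G; x divides c; y divides c\<rbrakk> \<Longrightarrow> l divides c"
  using assms by (auto simp: is_lcm_def)

lemma wt_one: "wt \<one> = 0"
  using wt_mult[of \<one> \<one>] by simp

lemma divides_imp_wt_le:
  assumes "x divides y" "x \<in> carrier G"
  shows "wt x \<le> wt y"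
  using assms wt_mult by (auto simp: factor_def)

lemma one_divides: "x \<in> carrier G \<Longrightarrow> \<one> divides x"
  by (auto simp: factor_def)

lemma divides_wt_le_imp_eq:
  assumes "x divides y" "x \<in> carrier G" "wt y \<le> wt x"
  shows "x = y"
proof -
  obtain c where "c \<in> carrier G" "y = x \<otimes> c"
    using assms(1) by (auto simp: factor_def)
  with assms wt_mult wt_eq_0 show ?thesis by fastforce
qed

lemma divides_antisym_eq:
  assumes "x divides y" "y divides x" "x \<in> carrier G" "y \<in> carrier G"
  shows "x = y"
  using assms divides_imp_wt_le divides_wt_le_imp_eq by blast

lemma divides_left_cancel:
  assumes "a \<otimes> x divides a \<otimes> y" "a \<in> carrier G" "x \<in> carrier G" "y \<in> carrier G"
  shows "x divides y"
proof -
  obtain c where c: "c \<in> carrier G" "a \<otimes> y = a \<otimes> x \<otimes> c"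
    using assms(1) by (auto simp: factor_def)
  then have "y = x \<otimes> c"
    using assms left_cancel[of a y "x \<otimes> c"] by (simp add: m_assoc)
  with c show ?thesis by (auto simp: factor_def)
qed

text \<open>Every multiple of \<open>a \<otimes> x\<close> has the form
  \<open>a \<otimes> c'\<close>, and left cancellation reduces minimality to that of
  \<open>l\<close>.\<close>

lemma is_lcm_mult_left:
  assumes "is_lcm x y l" "a \<in> carrier G" "x \<in> carrier G" "y \<in> carrier G"
  shows "is_lcm (a \<otimes> x) (a \<otimes> y) (a \<otimes> l)"
  unfolding is_lcm_def
proof (intro conjI ballI impI)
  note l = is_lcmD[OF assms(1)]
  show "a \<otimes> l \<in> carrier G" "a \<otimes> x divides a \<otimes> l" "a \<otimes> y divides a \<otimes> l"
    using assms l by auto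
  fix c assume c: "c \<in> carrier G" "a \<otimes> x divides c" "a \<otimes> y divides c"
  then obtain c' where c': "c' \<in> carrier G" "c = a \<otimes> c'"
    using assms by (auto simp: factor_def m_assoc)
  with c assms have "x divides c'" "y divides c'"
    using divides_left_cancel by blast+
  with c' l(1,4) assms show "a \<otimes> l divides c"
    by auto
qed

text \<open>Induction on the weight of the common multiple \<open>m\<close>. Let atoms
  \<open>a\<close>, \<open>b\<close> begin \<open>x\<close>, \<open>y\<close>, and let
  \<open>L\<close> be their lcm. The lcm \<open>r\<close> of \<open>x\<close> and \<open>L\<close>,
  the lcm \<open>s\<close> of \<open>y\<close> and \<open>L\<close>, and finally the lcm of
  \<open>r\<close> and \<open>s\<close> each concern two elements with a common initial factor;
  cancelling it lowers the weight.\<close>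

lemma is_lcm_exists:
  assumes "x divides m" "y divides m" "x \<in> carrier G" "y \<in> carrier G" "m \<in> carrier G"
  shows "\<exists>l. is_lcm x y l"
  using assms
proof (induction "wt m" arbitrary: x y m rule: less_induct)
  case less
  note dvd = less.prems(1,2) and closed [simp] = less.prems(3-5)
  consider "x = \<one>" | "y = \<one>" | "x \<noteq> \<one>" "y \<noteq> \<one>" by blast
  then show ?case
  proof cases
    case 1
    then have "is_lcm x y y" using one_divides by (auto simp: is_lcm_def)
    then show ?thesis ..
  next
    case 2
    then have "is_lcm x y x" using one_divides by (auto simp: is_lcm_def)
    then show ?thesis ..
  next
    case 3
    obtain a u where a: "a \<in> A" and u [simp]: "u \<in> carrier G" and x: "x = a \<otimes> u"
      using atom_factor 3 by (metis closed(1))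
    obtain b v where b: "b \<in> A" and v [simp]: "v \<in> carrier G" and y: "y = b \<otimes> v"
      using atom_factor 3 by (metis closed(2))
    have ab [simp]: "a \<in> carrier G" "b \<in> carrier G"
      using a b atoms_closed by auto
    have am: "a divides m" "b divides m"
      using dvd unfolding x y by (auto simp: factor_def m_assoc)
    obtain L where [simp]: "L \<in> carrier G" and L: "a divides L" "b divides L"
      "\<And>c. \<lbrakk>c \<in> carrier G; a divides c; b divides c\<rbrakk> \<Longrightarrow> L divides c"
      using atom_lcm[OF a b _ am] by auto
    have step: "\<exists>r. is_lcm z L r"
      if z: "z = c \<otimes> w" "z divides m" and w [simp]: "w \<in> carrier G" and c: "c \<in> A" "c divides L" for z c w
    proof -
      have [simp]: "c \<in> carrier G" using c atoms_closed by auto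
      obtain p where p [simp]: "p \<in> carrier G" and Lp: "L = c \<otimes> p"
        using c(2) by (auto simp: factor_def)
      have "c divides m"
        using z by (auto simp: factor_def m_assoc)
      then obtain m' where m' [simp]: "m' \<in> carrier G" and m: "m = c \<otimes> m'"
        by (auto simp: factor_def)
      have "w divides m'"
        using divides_left_cancel[of c w m'] z m by simp
      moreover have "p divides m'"
        using divides_left_cancel[of c p m'] L(3)[of m] am Lp m by simp
      moreover have "wt m' < wt m"
        using wt_atom[OF c(1)] m wt_mult by simp
      ultimately obtain r where "is_lcm w p r"
        using less.hyps by (metis m' p w)
      then show ?thesis
        using is_lcm_mult_left[of w p r c] z Lp by auto
    qed
    obtain r where r: "is_lcm x L r"
      using step[OF x dvd(1) u a L(1)] by blast
    obtain s where s: "is_lcm y L s"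
      using step[OF y dvd(2) v b L(2)] by blast
    have Lm: "L divides m" using L(3) am by simp
    note rD = is_lcmD[OF r] and sD = is_lcmD[OF s]
    obtain m' where m' [simp]: "m' \<in> carrier G" and m: "m = L \<otimes> m'"
      using Lm by (auto simp: factor_def)
    obtain r' where r' [simp]: "r' \<in> carrier G" and rL: "r = L \<otimes> r'"
      using rD(3) by (auto simp: factor_def)
    obtain s' where s' [simp]: "s' \<in> carrier G" and sL: "s = L \<otimes> s'"
      using sD(3) by (auto simp: factor_def)
    have "r' divides m'"
      using divides_left_cancel[of L r' m'] rD(4)[of m] dvd Lm rL m by simp
    moreover have "s' divides m'"
      using divides_left_cancel[of L s' m'] sD(4)[of m] dvd Lm sL m by simp
    moreover have "wt m' < wt m"
      using wt_atom[OF a] divides_imp_wt_le[OF L(1)] m wt_mult by simp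
    ultimately obtain t where "is_lcm r' s' t"
      using less.hyps by (metis m' r' s')
    then have t: "is_lcm r s (L \<otimes> t)"
      using is_lcm_mult_left[of r' s' t L] rL sL by simp
    note tD = is_lcmD[OF t]
    \<comment> \<open>A common multiple of \<open>x\<close> and \<open>y\<close> is one of
      \<open>a\<close> and \<open>b\<close>, hence a multiple of \<open>L\<close>, hence of
      \<open>r\<close> and of \<open>s\<close>.\<close>
    have "is_lcm x y (L \<otimes> t)"
      unfolding is_lcm_def
    proof (intro conjI ballI impI)
      show "L \<otimes> t \<in> carrier G" by (rule tD)
      show "x divides L \<otimes> t" "y divides L \<otimes> t"
        using divides_trans[OF rD(2) tD(2)] divides_trans[OF sD(2) tD(3)] by auto
      fix c assume c: "c \<in> carrier G" "x divides c" "y divides c"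
      then have "a divides c" "b divides c"
        unfolding x y by (auto simp: factor_def m_assoc)
      with c have "L divides c" using L(3) by blast
      with c show "L \<otimes> t divides c"
        by (intro tD(4) rD(4) sD(4))
    qed
    then show ?thesis ..
  qed
qed

section \<open>Sets closed under least common multiples\<close>

definition lcm_closed :: "'a set \<Rightarrow> bool" where
  "lcm_closed S \<longleftrightarrow> (\<forall>x\<in>S. \<forall>y\<in>S. \<forall>l. is_lcm x y l \<longrightarrow> l \<in> S)"

lemma lcm_closed_divisors:
  assumes "lcm_closed S" "y \<in> carrier G"
  shows "lcm_closed {z \<in> S. z divides y}"
  using assms is_lcmD unfolding lcm_closed_def by blast

text \<open>Weights are bounded by that of \<open>T\<close>. An element \<open>g\<close> of largest
  weight absorbs every \<open>x\<close>: their lcm lies in \<open>S\<close>, is a multiple of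
  \<open>g\<close> and weighs no more than \<open>g\<close>, so it equals \<open>g\<close>.\<close>

lemma lcm_closed_greatest:
  assumes "lcm_closed S" "S \<subseteq> carrier G" "S \<noteq> {}" "T \<in> carrier G" "\<And>x. x \<in> S \<Longrightarrow> x divides T"
  shows "\<exists>g\<in>S. \<forall>x\<in>S. x divides g"
proof -
  have "wt x < Suc (wt T)" if "x \<in> S" for x
    using divides_imp_wt_le assms that by (auto simp: less_Suc_eq_le)
  then obtain g where g: "g \<in> S" "\<And>x. x \<in> S \<Longrightarrow> wt x \<le> wt g"
    using ex_has_greatest_nat[of "\<lambda>x. x \<in> S" _ wt "Suc (wt T)"] assms(3) by (metis ex_in_conv less_imp_le)
  have "x divides g" if x: "x \<in> S" for x
  proof -
    obtain l where l: "is_lcm g x l"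
      using is_lcm_exists[of g T x] assms(2,4,5) g(1) x by blast
    then have "l \<in> S"
      using assms(1) g(1) x unfolding lcm_closed_def by blast
    then have "g = l"
      using divides_wt_le_imp_eq[of g l] is_lcmD(2)[OF l] g assms(2) by blast
    with is_lcmD(3)[OF l] show ?thesis by simp
  qed
  with g show ?thesis by blast
qed

section \<open>Lattices ordered by divisibility\<close>

abbreviation dvd_poset :: "'a set \<Rightarrow> 'a gorder" where
  "dvd_poset X \<equiv> \<lparr>carrier = X, eq = (=), le = (\<lambda>x y. x divides y)\<rparr>"

lemma is_lub_dvd_poset:
  assumes "S \<subseteq> X"
  shows "is_lub (dvd_poset X) l S \<longleftrightarrow>
    l \<in> X \<and> (\<forall>x\<in>S. x divides l) \<and> (\<forall>u\<in>X. (\<forall>x\<in>S. x divides u) \<longrightarrow> l divides u)"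
  using assms by (fastforce simp: least_def Upper_def)

lemma is_glb_dvd_poset:
  assumes "S \<subseteq> X"
  shows "is_glb (dvd_poset X) l S \<longleftrightarrow>
    l \<in> X \<and> (\<forall>x\<in>S. l divides x) \<and> (\<forall>u\<in>X. (\<forall>x\<in>S. u divides x) \<longrightarrow> u divides l)"
  using assms by (fastforce simp: greatest_def Lower_def)

lemma partial_order_dvd_poset:
  assumes "X \<subseteq> carrier G"
  shows "partial_order (dvd_poset X)"
  by unfold_locales (use assms in \<open>auto dest: subsetD intro: divides_antisym_eq divides_trans\<close>)

text \<open>Joins are lcms, which exist because \<open>T\<close> is a common multiple. The meet is
  the greatest common divisor within \<open>X\<close>: the common divisors in \<open>X\<close> are
  closed under lcms, and \<open>B\<close> is one of them.\<close>

lemma lcm_closed_lattice: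
  assumes X: "lcm_closed X" "X \<subseteq> carrier G"
    and T: "T \<in> carrier G" "\<And>x. x \<in> X \<Longrightarrow> x divides T"
    and B: "B \<in> X" "\<And>x. x \<in> X \<Longrightarrow> B divides x"
  shows "lattice (dvd_poset X)"
proof -
  interpret partial_order "dvd_poset X"
    using X(2) by (rule partial_order_dvd_poset)
  show ?thesis
  proof (unfold_locales)
    fix x y assume "x \<in> carrier (dvd_poset X)" "y \<in> carrier (dvd_poset X)"
    then have xy: "x \<in> X" "y \<in> X" by simp_all
    then obtain l where l: "is_lcm x y l"
      using is_lcm_exists[of x T y] X T by blast
    with X(1) xy have "l \<in> X" unfolding lcm_closed_def by blast
    with l X(2) xy have "is_lub (dvd_poset X) l {x, y}"
      by (subst is_lub_dvd_poset) (auto simp: is_lcm_def)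
    then show "\<exists>s. is_lub (dvd_poset X) s {x, y}" ..
    let ?S = "{z \<in> {z \<in> X. z divides x}. z divides y}"
    have "lcm_closed ?S"
      using X xy by (intro lcm_closed_divisors) (simp_all add: subset_iff)
    moreover have "?S \<subseteq> carrier G" "\<And>z. z \<in> ?S \<Longrightarrow> z divides T"
      using X(2) T(2) by auto
    moreover have "B \<in> ?S"
      using B xy by simp
    ultimately have "\<exists>g\<in>?S. \<forall>z\<in>?S. z divides g"
      using T(1) by (intro lcm_closed_greatest[of _ T]) (simp_all, blast)
    then obtain g where "g \<in> ?S" "\<And>z. z \<in> ?S \<Longrightarrow> z divides g" by blast
    then have "is_glb (dvd_poset X) g {x, y}"
      using xy by (subst is_glb_dvd_poset) auto
    then show "\<exists>s. is_glb (dvd_poset X) s {x, y}" ..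
  qed
qed

text \<open>The meet is a choice among greatest lower bounds, which antisymmetry makes
  unique.\<close>

lemma meet_dvd_poset:
  assumes "X \<subseteq> carrier G" "is_glb (dvd_poset X) g {x, y}"
  shows "x \<sqinter>\<^bsub>dvd_poset X\<^esub> y = g"
proof -
  interpret partial_order "dvd_poset X"
    using assms(1) by (rule partial_order_dvd_poset)
  have "is_glb (dvd_poset X) (x \<sqinter>\<^bsub>dvd_poset X\<^esub> y) {x, y}"
    unfolding meet_def inf_def using assms(2) by (rule someI)
  with assms(2) show ?thesis by (rule greatest_unique[symmetric])
qed

lemma sup_dvd_poset:
  assumes "X \<subseteq> carrier G" "is_lub (dvd_poset X) g S"
  shows "\<Squnion>\<^bsub>dvd_poset X\<^esub> S = g"
proof -
  interpret partial_order "dvd_poset X"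
    using assms(1) by (rule partial_order_dvd_poset)
  have "is_lub (dvd_poset X) (\<Squnion>\<^bsub>dvd_poset X\<^esub> S) S"
    unfolding sup_def using assms(2) by (rule someI)
  with assms(2) show ?thesis by (rule least_unique[symmetric])
qed

end

section \<open>The divisors of \<open>\<Delta>\<close>\<close>

declare One_nat_def [simp del]

text \<open>Independent of the chosen representative, because the relations are homogeneous.\<close>

definition weight :: "nat list set \<Rightarrow> nat" where
  "weight X = sum_list (SOME u. u \<in> X)"

locale rho_monoid =
  fixes n :: nat and G :: "nat list set monoid" (structure)
  assumes n_pos: "n \<ge> 1" and G_def: "G = M n"
begin

section \<open>From words to elements of the monoid\<close>

definition cls :: "nat list \<Rightarrow> nat list set" where
  "cls u = pres_cong {1..n} (M_rels n) `` {u}"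

abbreviation r :: "nat \<Rightarrow> nat list set" where
  "r i \<equiv> \<rho> n i"

definition \<tau> :: "nat list set" where
  "\<tau> = r 1 \<otimes> r n"

sublocale monoid G
  unfolding G_def M_def by (rule monoid_pres_monoid)

lemma cls_closed [simp]: "u \<in> lists {1..n} \<Longrightarrow> cls u \<in> carrier G"
  by (auto simp: G_def M_def pres_monoid_def cls_def intro: quotientI)

lemma cls_mult: "u \<in> lists {1..n} \<Longrightarrow> v \<in> lists {1..n} \<Longrightarrow> cls u \<otimes> cls v = cls (u @ v)"
  unfolding G_def M_def cls_def by (rule pres_monoid_mult_class)

lemma cls_Nil: "cls [] = \<one>"
  by (simp add: G_def M_def pres_monoid_def cls_def)

lemma cls_eq: "cong_word n u v \<Longrightarrow> cls u = cls v"
  unfolding cls_def by (rule equiv_class_eq[OF equiv_pres_cong])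

lemma cls_eqD: "cls u = cls v \<Longrightarrow> v \<in> lists {1..n} \<Longrightarrow> cong_word n u v"
  unfolding cls_def using eq_equiv_class[OF _ equiv_pres_cong] by blast

lemma carrier_cases:
  assumes "z \<in> carrier G"
  obtains u where "u \<in> lists {1..n}" "z = cls u"
proof -
  have "z \<in> lists {1..n} // pres_cong {1..n} (M_rels n)"
    using assms by (simp add: G_def M_def pres_monoid_def)
  then show ?thesis
    by (rule quotientE) (simp add: that cls_def)
qed

lemma rho_eq_cls: "r i = cls [i]"
  by (simp add: \<rho>_def cls_def)

lemma r_closed [simp]: "1 \<le> i \<Longrightarrow> i \<le> n \<Longrightarrow> r i \<in> carrier G"
  by (simp add: rho_eq_cls)

lemma cls_Cons: "1 \<le> i \<Longrightarrow> i \<le> n \<Longrightarrow> u \<in> lists {1..n} \<Longrightarrow> cls (i # u) = r i \<otimes> cls u"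
  by (simp add: rho_eq_cls cls_mult)

lemma rn_closed [simp]: "r n \<in> carrier G" "r 1 \<in> carrier G"
  using n_pos by simp_all

lemma tau_closed [simp]: "\<tau> \<in> carrier G"
  by (simp add: \<tau>_def)

lemma pow_1 [simp]: "z \<in> carrier G \<Longrightarrow> z [^] (1::nat) = z"
  by (simp add: One_nat_def)

lemma pow_add_1 [simp]: "z [^] (k + 1 :: nat) = z [^] k \<otimes> z"
  by (simp flip: Suc_eq_plus1)

lemma pow_pred: "1 \<le> k \<Longrightarrow> z [^] (k - 1 :: nat) \<otimes> z = z [^] k"
  using nat_pow_Suc[of z "k - 1"] by simp

lemma cls_replicate: "cls (replicate k n) = r n [^] k"
proof (induction k)
  case (Suc k)
  then show ?case
    using n_pos replicate_in_lists[OF n_pos, of k] nat_pow_Suc2[of "r n" k] by (simp add: cls_Cons)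
qed (simp add: cls_Nil)

lemma weight_cls: "u \<in> lists {1..n} \<Longrightarrow> weight (cls u) = sum_list u"
proof -
  assume u: "u \<in> lists {1..n}"
  then have "u \<in> cls u" by (auto simp: cls_def intro: pres_cong.refl)
  then have "(SOME v. v \<in> cls u) \<in> cls u" by (rule someI)
  then show ?thesis
    using cong_word_sum_list by (auto simp: weight_def cls_def)
qed

text \<open>This is \<open>cong_word_imp_word_residual\<close> for distinct first letters, read in
  the monoid. It serves both for the lcms of generators and for showing that a generator does not
  divide.\<close>

lemma rho_eq_cases:
  assumes "r j \<otimes> X = r k \<otimes> Y" "1 \<le> j" "j < k" "k \<le> n" "X \<in> carrier G" "Y \<in> carrier G"
  obtains W where "W \<in> carrier G" "X = r n [^] j \<otimes> r (k - j) \<otimes> W" "Y = r n [^] j \<otimes> W"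
proof -
  obtain u v where uv: "u \<in> lists {1..n}" "X = cls u" "v \<in> lists {1..n}" "Y = cls v"
    using assms(5,6) by (meson carrier_cases)
  then have "cls (j # u) = cls (k # v)"
    using assms by (simp add: cls_Cons)
  then have "cong_word n (j # u) (k # v)"
    using uv assms by (intro cls_eqD) auto
  then have "residual n j u k v"
    using cong_word_imp_word_residual by fastforce
  then obtain w where w: "cong_word n u (replicate j n @ [k - j] @ w)" "cong_word n v (replicate j n @ w)"
    using assms(3) by (auto simp: residual_def residual_less_def)
  have "1 \<le> k - j" using assms(3) by simp
  have wl: "w \<in> lists {1..n}" using cong_word_lists[OF w(2)] by simp
  show ?thesis
  proof (rule that[of "cls w"])
    show "X = r n [^] j \<otimes> r (k - j) \<otimes> cls w" "Y = r n [^] j \<otimes> cls w"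
      using w[THEN cls_eq] wl assms uv replicate_in_lists[OF n_pos, of j] \<open>1 \<le> k - j\<close>
      by (simp_all add: cls_mult[symmetric] cls_replicate cls_Cons m_assoc)
  qed (use wl in simp)
qed

lemma cancel:
  assumes "c \<otimes> X = c \<otimes> Y" "c \<in> carrier G" "X \<in> carrier G" "Y \<in> carrier G"
  shows "X = Y"
proof -
  obtain p u v where "p \<in> lists {1..n}" "c = cls p" "u \<in> lists {1..n}" "X = cls u" "v \<in> lists {1..n}" "Y = cls v"
    using assms(2-4) by (meson carrier_cases)
  moreover from this have "cong_word n (p @ u) (p @ v)"
    using assms(1) by (intro cls_eqD) (auto simp: cls_mult)
  ultimately show ?thesis
    using cls_eq cong_word_cancel by metis
qed

lemma rho_lcm_relation:
  assumes "1 \<le> j" "j < k" "k \<le> n"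
  shows "r j \<otimes> (r n [^] j \<otimes> r (k - j)) = r k \<otimes> r n [^] j"
proof -
  have "1 \<le> k - j" using assms by simp
  then show ?thesis
    using cls_eq[OF lcm_relation[OF assms]] assms replicate_in_lists[OF n_pos, of j]
    by (simp add: cls_mult[symmetric] cls_replicate cls_Cons cls_Nil)
qed

text \<open>\<open>rho_lcm_relation\<close> makes \<open>r k \<otimes> r n [^] j\<close> a common
  multiple, and \<open>rho_eq_cases\<close> makes it divide every other one.\<close>

lemma rho_lcm_exists:
  assumes "1 \<le> j" "j < k" "k \<le> n" "m \<in> carrier G" "r j divides m" "r k divides m"
  shows "\<exists>l\<in>carrier G. r j divides l \<and> r k divides l \<and>
        (\<forall>c\<in>carrier G. r j divides c \<longrightarrow> r k divides c \<longrightarrow> l divides c)"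
proof (intro bexI[of _ "r k \<otimes> r n [^] j"] conjI ballI impI)
  show "r j divides r k \<otimes> r n [^] j"
    using assms rho_lcm_relation[of j k] by (intro dividesI[of "r n [^] j \<otimes> r (k - j)"]) simp_all
  show "r k divides r k \<otimes> r n [^] j"
    using assms by (intro dividesI) simp_all
  show "r k \<otimes> r n [^] j \<in> carrier G" using assms by simp
  fix c assume c: "c \<in> carrier G" "r j divides c" "r k divides c"
  then obtain X Y where XY: "X \<in> carrier G" "c = r j \<otimes> X" "Y \<in> carrier G" "c = r k \<otimes> Y"
    by (auto simp: factor_def)
  obtain W where W: "W \<in> carrier G" "Y = r n [^] j \<otimes> W"
    using rho_eq_cases[of j X k Y] XY assms by (metis (no_types))
  then show "r k \<otimes> r n [^] j divides c"
    using XY assms by (intro dividesI[of W]) (simp_all add: m_assoc)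
qed

sublocale lcm_monoid G weight "r ` {1..n}"
proof
  fix a z y m b c
  show "a \<in> carrier G" if "a \<in> r ` {1..n}" using that by auto
  show "z = y" if "c \<otimes> z = c \<otimes> y" "c \<in> carrier G" "z \<in> carrier G" "y \<in> carrier G"
    using that by (rule cancel)
  show "weight (z \<otimes> y) = weight z + weight y" if "z \<in> carrier G" "y \<in> carrier G"
    using that by (elim carrier_cases) (simp add: cls_mult weight_cls)
  show "z = \<one>" if z: "z \<in> carrier G" "weight z = 0"
  proof -
    obtain u where "u \<in> lists {1..n}" "z = cls u" using z(1) by (rule carrier_cases)
    with z show ?thesis by (cases u) (auto simp: weight_cls cls_Nil)
  qed
  show "weight a > 0" if "a \<in> r ` {1..n}"
    using that by (auto simp: rho_eq_cls weight_cls)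
  show "\<exists>a\<in>r ` {1..n}. \<exists>y\<in>carrier G. z = a \<otimes> y" if z: "z \<in> carrier G" "z \<noteq> \<one>"
  proof -
    obtain u where u: "u \<in> lists {1..n}" "z = cls u" using z(1) by (rule carrier_cases)
    with z(2) obtain i v where "u = i # v" by (cases u) (auto simp: cls_Nil)
    with u show ?thesis
      by (intro bexI[of _ "r i"] bexI[of _ "cls v"]) (auto simp: cls_Cons)
  qed
  show "\<exists>l\<in>carrier G. a divides l \<and> b divides l \<and>
        (\<forall>c\<in>carrier G. a divides c \<longrightarrow> b divides c \<longrightarrow> l divides c)"
    if ab: "a \<in> r ` {1..n}" "b \<in> r ` {1..n}" and m: "m \<in> carrier G" "a divides m" "b divides m"
  proof -
    obtain j k where jk: "a = r j" "b = r k" "j \<in> {1..n}" "k \<in> {1..n}"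
      using ab by auto
    consider "j < k" | "k < j" | "j = k" by linarith
    then show ?thesis
    proof cases
      case 1
      then show ?thesis using rho_lcm_exists[of j k m] jk m by auto
    next
      case 2
      then obtain l where "l \<in> carrier G" "b divides l" "a divides l"
        "\<forall>c\<in>carrier G. b divides c \<longrightarrow> a divides c \<longrightarrow> l divides c"
        using rho_lcm_exists[of k j m] jk m by auto
      then show ?thesis by blast
    next
      case 3
      then show ?thesis using jk by (intro bexI[of _ a]) auto
    qed
  qed
qed

section \<open>Powers of \<open>\<tau>\<close> and the central element
  \<open>\<Delta>\<close>\<close>

lemma rho_relation: "1 \<le> i \<Longrightarrow> i < n \<Longrightarrow> \<tau> \<otimes> r i = r (i + 1) \<otimes> r n"
  using rho_lcm_relation[of 1 "i + 1"] by (simp add: m_assoc \<tau>_def)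

text \<open>Each further factor \<open>r n\<close> is absorbed by \<open>rho_relation\<close>, which
  splits off one more \<open>\<tau>\<close> and lowers the index of the last generator by
  one.\<close>

lemma rn_pow_eq: "1 \<le> m \<Longrightarrow> m \<le> n \<Longrightarrow> r n [^] m = \<tau> [^] (m - 1) \<otimes> r (n + 1 - m)"
proof (induction m rule: nat_induct_at_least)
  case (Suc m)
  have "r n [^] Suc m = \<tau> [^] (m - 1) \<otimes> (r (n - m + 1) \<otimes> r n)"
    using Suc by (simp add: m_assoc Suc_diff_le)
  also have "\<dots> = \<tau> [^] (m - 1) \<otimes> (\<tau> \<otimes> r (n - m))"
    using Suc rho_relation[of "n - m"] by simp
  also have "\<dots> = \<tau> [^] m \<otimes> r (n - m)"
    using Suc by (simp add: pow_pred flip: m_assoc)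
  finally show ?case by simp
qed simp

text \<open>Again \<open>rho_relation\<close>: a new \<open>\<tau>\<close> on the left raises the
  index of the first generator by one and releases a factor \<open>r n\<close>.\<close>

lemma tau_pow_eq: "1 \<le> i \<Longrightarrow> i \<le> n \<Longrightarrow> \<tau> [^] i = r i \<otimes> r n [^] i"
proof (induction i rule: nat_induct_at_least)
  case (Suc i)
  have "\<tau> [^] Suc i = \<tau> \<otimes> \<tau> [^] i"
    by (rule nat_pow_Suc2) simp
  also have "\<dots> = \<tau> \<otimes> r i \<otimes> r n [^] i"
    using Suc by (simp add: m_assoc)
  also have "\<dots> = r (i + 1) \<otimes> (r n \<otimes> r n [^] i)"
    using Suc by (simp add: rho_relation m_assoc)
  also have "r n \<otimes> r n [^] i = r n [^] Suc i"
    by (rule nat_pow_Suc2[symmetric]) simp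
  finally show ?case by (simp only: Suc_eq_plus1)
qed (simp add: \<tau>_def)

lemma Delta_eq: "\<Delta> n = r n [^] (n + 1)"
  by (simp add: \<Delta>_def G_def)

lemma Delta_closed [simp]: "\<Delta> n \<in> carrier G"
  by (simp add: Delta_eq)

text \<open>For exponent \<open>n\<close>, \<open>rn_pow_eq\<close> leaves \<open>r 1\<close> at the
  end; the one remaining factor \<open>r n\<close> completes the last \<open>\<tau>\<close>.\<close>

lemma Delta_eq_tau_pow: "\<Delta> n = \<tau> [^] n"
proof -
  have "\<Delta> n = \<tau> [^] (n - 1) \<otimes> r 1 \<otimes> r n"
    using rn_pow_eq[of n] n_pos by (simp add: Delta_eq m_assoc)
  also have "\<dots> = \<tau> [^] Suc (n - 1)"
    by (simp add: m_assoc \<tau>_def)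
  finally show ?thesis using n_pos by (simp del: nat_pow_Suc)
qed

text \<open>Cut \<open>\<Delta>\<close> after \<open>i\<close> factors \<open>r n\<close>. The first
  part together with \<open>r i\<close> is \<open>\<tau> [^] i\<close>, the second is
  \<open>\<tau> [^] (n - i) \<otimes> r i\<close>, so \<open>r i\<close> reappears on the right of
  \<open>\<tau> [^] n\<close>.\<close>

lemma rho_Delta_commute:
  assumes "1 \<le> i" "i \<le> n"
  shows "r i \<otimes> \<Delta> n = \<Delta> n \<otimes> r i"
proof -
  have "r i \<otimes> \<Delta> n = r i \<otimes> (r n [^] i \<otimes> r n [^] (n + 1 - i))"
    using assms by (simp add: Delta_eq nat_pow_mult del: nat_pow_Suc)
  also have "\<dots> = \<tau> [^] i \<otimes> (\<tau> [^] (n - i) \<otimes> r i)"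
    using assms rn_pow_eq[of "n + 1 - i"] by (simp add: tau_pow_eq m_assoc)
  also have "\<dots> = \<tau> [^] n \<otimes> r i"
    using assms by (simp add: nat_pow_mult flip: m_assoc)
  finally show ?thesis by (simp add: Delta_eq_tau_pow)
qed

lemma Delta_central:
  assumes "z \<in> carrier G"
  shows "z \<otimes> \<Delta> n = \<Delta> n \<otimes> z"
proof -
  have "cls u \<otimes> \<Delta> n = \<Delta> n \<otimes> cls u" if "u \<in> lists {1..n}" for u
    using that
  proof (induction u)
    case (Cons i u)
    then have i: "1 \<le> i" "i \<le> n" "u \<in> lists {1..n}" by auto
    then have "cls (i # u) \<otimes> \<Delta> n = (r i \<otimes> \<Delta> n) \<otimes> cls u"
      using Cons.IH by (simp add: cls_Cons m_assoc)
    also have "\<dots> = \<Delta> n \<otimes> cls (i # u)"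
      using i rho_Delta_commute by (simp add: cls_Cons m_assoc)
    finally show ?case .
  qed (simp add: cls_Nil)
  with assms show ?thesis by (metis carrier_cases)
qed

text \<open>Centrality gives \<open>a \<otimes> b \<otimes> a = a \<otimes> \<Delta> n\<close>;
  cancel \<open>a\<close>.\<close>

lemma Delta_factors_commute:
  assumes "a \<otimes> b = \<Delta> n" "a \<in> carrier G" "b \<in> carrier G"
  shows "b \<otimes> a = \<Delta> n"
proof (rule left_cancel)
  show "a \<otimes> (b \<otimes> a) = a \<otimes> \<Delta> n"
    using assms Delta_central[of a] by (simp flip: m_assoc)
qed (use assms in simp_all)

text \<open>If \<open>r k\<close> divides a power of \<open>\<tau>\<close>, which begins with
  \<open>r 1\<close>, then \<open>rho_eq_cases\<close> with \<open>j = 1\<close> shows that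
  \<open>r (k - 1)\<close> divides the next lower power. Descent ends at \<open>\<one>\<close>,
  which no generator divides.\<close>

lemma rho_not_divides_tau_pow:
  assumes "b < k" "k \<le> n"
  shows "\<not> r k divides \<tau> [^] b"
  using assms
proof (induction b arbitrary: k)
  case 0
  have "weight (r k) > 0" using 0 wt_atom by auto
  moreover have "r k divides \<one> \<Longrightarrow> weight (r k) \<le> weight \<one>"
    using 0 by (intro divides_imp_wt_le) auto
  ultimately show ?case by (auto simp: wt_one)
next
  case (Suc b)
  show ?case
  proof
    assume "r k divides \<tau> [^] Suc b"
    then obtain Y where Y: "Y \<in> carrier G" "\<tau> [^] Suc b = r k \<otimes> Y"
      by (auto simp: factor_def)
    have "r 1 \<otimes> (r n \<otimes> \<tau> [^] b) = r k \<otimes> Y"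
      using Y(2)[symmetric] nat_pow_Suc2[of \<tau> b] by (simp add: m_assoc \<tau>_def)
    then obtain W where W: "W \<in> carrier G" "r n \<otimes> \<tau> [^] b = r n [^] (1::nat) \<otimes> r (k - 1) \<otimes> W"
      using Suc.prems Y(1) by (elim rho_eq_cases) auto
    have "\<tau> [^] b = r (k - 1) \<otimes> W"
      by (rule left_cancel[of "r n"]) (use Suc.prems W in \<open>simp_all add: m_assoc\<close>)
    with W(1) have "r (k - 1) divides \<tau> [^] b" by auto
    with Suc show False by simp
  qed
qed

section \<open>Splittings of words for \<open>\<Delta>\<close>\<close>

definition good_split :: "nat list \<Rightarrow> nat list \<Rightarrow> bool" where
  "good_split s t \<longleftrightarrow> r n divides cls t \<or> (\<exists>u\<in>carrier G. cls s = u \<otimes> \<tau>)"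

text \<open>Whether a split is good depends only on the classes of its parts, but which splits occur
  depends on the word.\<close>

definition good_word :: "nat list \<Rightarrow> bool" where
  "good_word w \<longleftrightarrow> (\<forall>s t. w = s @ t \<longrightarrow> good_split s t)"

lemma good_split_cong: "cong_word n s s' \<Longrightarrow> cong_word n t t' \<Longrightarrow> good_split s t \<Longrightarrow> good_split s' t'"
  unfolding good_split_def using cls_eq by metis

text \<open>A cut outside \<open>v'\<close> or at one of its ends corresponds to a cut of the old
  word with congruent parts. Only cuts strictly inside \<open>v'\<close> are new, and these are the
  business of \<open>inner\<close>.\<close>

lemma good_word_replace:
  assumes "cong_word n v v'" "p \<in> lists {1..n}" "q \<in> lists {1..n}" "good_word (p @ v @ q)"
    and inner: "\<And>s t. \<lbrakk>v' = s @ t; s \<noteq> []; t \<noteq> []\<rbrakk> \<Longrightarrow> good_split (p @ s) (t @ q)"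
  shows "good_word (p @ v' @ q)"
  unfolding good_word_def
proof (intro allI impI)
  fix s t assume "p @ v' @ q = s @ t"
  then consider us where "p = s @ us" "t = us @ v' @ q"
    | us vs where "s = p @ us" "v' = us @ vs" "t = vs @ q"
    | us where "s = p @ v' @ us" "q = us @ t"
    by (auto simp: append_eq_append_conv2)
  then show "good_split s t"
  proof cases
    case 1
    then have "good_split s (us @ v @ q)"
      using assms(4) by (auto simp: good_word_def)
    then show ?thesis
      using assms(1-3) 1 by (elim good_split_cong[rotated 2])
        (auto intro: pres_cong.refl pres_cong.append)
  next
    case 2
    consider "us = []" | "vs = []" | "us \<noteq> []" "vs \<noteq> []" by blast
    then show ?thesis
    proof cases
      assume "us = []"
      then have "good_split p (v @ q)" "v' = vs" "s = p"
        using assms(4) 2 by (auto simp: good_word_def)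
      then show ?thesis
        using assms(1-3) 2 by (elim good_split_cong[rotated 2])
          (auto intro: pres_cong.refl pres_cong.append)
    next
      assume "vs = []"
      then have "good_split (p @ v) q" "v' = us" "t = q"
        using assms(4) 2 by (auto simp: good_word_def)
      then show ?thesis
        using assms(1-3) 2 by (elim good_split_cong[rotated 2])
          (auto intro: pres_cong.refl pres_cong.append)
    next
      assume "us \<noteq> []" "vs \<noteq> []"
      then show ?thesis using inner 2 by simp
    qed
  next
    case 3
    then have "good_split (p @ v @ us) t"
      using assms(4) by (auto simp: good_word_def)
    then show ?thesis
      using assms(1-3) 3 by (elim good_split_cong[rotated 2])
        (auto intro: pres_cong.refl pres_cong.append)
  qed
qed

lemma good_split_Cons: "t \<in> lists {1..n} \<Longrightarrow> good_split s (n # t)"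
  using n_pos unfolding good_split_def by (intro disjI1 dividesI[of "cls t"]) (simp_all add: cls_Cons)

lemma good_split_append: "s \<in> lists {1..n} \<Longrightarrow> good_split (s @ [1, n]) t"
proof -
  assume s: "s \<in> lists {1..n}"
  have "cls (s @ [1, n]) = cls s \<otimes> \<tau>"
    using s n_pos by (simp add: cls_mult[symmetric] cls_Cons cls_Nil \<tau>_def)
  with s show ?thesis unfolding good_split_def by (metis cls_closed)
qed

text \<open>The contexts \<open>p\<close> and \<open>q\<close> are arbitrary so that in the
  \<open>append\<close> case each factor can be replaced with the other one as part of its
  context.\<close>

lemma good_word_cong:
  assumes "cong_word n u v" "p \<in> lists {1..n}" "q \<in> lists {1..n}"
  shows "good_word (p @ u @ q) \<longleftrightarrow> good_word (p @ v @ q)"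
  using assms
proof (induction arbitrary: p q rule: pres_cong.induct)
  case (base u v)
  then obtain i where uv: "u = [1, n, i]" "v = [i + 1, n]" and i: "1 \<le> i" "i < n"
    by (auto simp: M_rels_def)
  have c: "cong_word n u v" using base by (intro pres_cong.base)
  \<comment> \<open>The inner cuts of a relation are \<open>[1]\<close> before
    \<open>[n, i]\<close>, \<open>[1, n]\<close> before \<open>[i]\<close>, and
    \<open>[i + 1]\<close> before \<open>[n]\<close>: the right part starts with \<open>n\<close> or
    the left part ends with \<open>[1, n]\<close>.\<close>
  have splits: "good_split w (n # q)" "good_split w (n # i # q)" "good_split (p @ [1, n]) w" for w
    using base(4,5) i by (auto intro!: good_split_Cons good_split_append simp del: in_lists_conv_set)
  have "good_split (p @ s) (t @ q)" if "v = s @ t" "s \<noteq> []" "t \<noteq> []" for s t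
    using that uv splits by (auto simp: Cons_eq_append_conv)
  moreover have "good_split (p @ s) (t @ q)" if "u = s @ t" "s \<noteq> []" "t \<noteq> []" for s t
    using that uv splits by (auto simp: Cons_eq_append_conv)
  ultimately show ?case
    using good_word_replace[OF c base(4,5)] good_word_replace[OF pres_cong.sym[OF c] base(4,5)]
    by blast
next
  case (append u u' v v')
  have "u' \<in> lists {1..n}" "v \<in> lists {1..n}"
    using append.hyps cong_word_lists by blast+
  then show ?case
    using append.IH(1)[of p "v @ q"] append.IH(2)[of "p @ u'" q] append.prems by simp
qed auto

text \<open>A nonempty right part begins with \<open>n\<close>. If it is empty, the left part is
  \<open>\<Delta> n = \<tau> [^] n\<close>, which ends in \<open>\<tau>\<close> since
  \<open>n \<ge> 1\<close>.\<close>

lemma good_word_Delta: "good_word (replicate (n + 1) n)"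
  unfolding good_word_def
proof (intro allI impI)
  fix s t assume st: "replicate (n + 1) n = s @ t"
  show "good_split s t"
  proof (cases t)
    case Nil
    have "cls s = \<tau> [^] (n - 1) \<otimes> \<tau>"
      using st Nil cls_replicate[of "n + 1"] n_pos Delta_eq Delta_eq_tau_pow by (simp add: pow_pred)
    then show ?thesis by (auto simp: good_split_def)
  next
    case (Cons a t')
    have "set (s @ t) \<subseteq> {n}" by (simp flip: st)
    then have "a = n" "t' \<in> lists {1..n}" using Cons n_pos by auto
    with Cons show ?thesis by (simp add: good_split_Cons)
  qed
qed

text \<open>The complement \<open>z'\<close> of \<open>z\<close> is also a left complement, so
  \<open>z'\<close> followed by \<open>z\<close> splits a word for \<open>\<Delta>\<close> with
  \<open>z\<close> on the right. As \<open>r n\<close> does not divide \<open>z\<close>, the factor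
  \<open>\<tau>\<close> must end \<open>z'\<close>.\<close>

lemma divides_tau_pow:
  assumes z: "z \<in> carrier G" "z divides \<Delta> n" and "\<not> r n divides z"
  shows "z divides \<tau> [^] (n - 1)"
proof -
  obtain z' where z': "z' \<in> carrier G" "z \<otimes> z' = \<Delta> n"
    using z(2) by (auto simp: factor_def)
  then have "z' \<otimes> z = \<Delta> n"
    using Delta_factors_commute z(1) by blast
  moreover obtain s t where st: "s \<in> lists {1..n}" "z' = cls s" "t \<in> lists {1..n}" "z = cls t"
    using z(1) z'(1) by (meson carrier_cases)
  ultimately have "cls (s @ t) = cls (replicate (n + 1) n)"
    by (simp add: cls_mult cls_replicate Delta_eq del: replicate_Suc nat_pow_Suc)
  then have "cong_word n (s @ t) (replicate (n + 1) n)"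
    using replicate_in_lists[OF n_pos] by (rule cls_eqD)
  then have "good_word (s @ t)"
    using good_word_cong[of _ _ "[]" "[]"] good_word_Delta by fastforce
  then have "good_split s t" by (simp add: good_word_def)
  with st assms(3) obtain u where u: "u \<in> carrier G" "z' = u \<otimes> \<tau>"
    by (auto simp: good_split_def)
  \<comment> \<open>Rotating \<open>\<tau>\<close> from the end to the front makes left cancellation
    applicable.\<close>
  have "\<tau> \<otimes> (z \<otimes> u) = \<Delta> n"
    by (rule Delta_factors_commute[of "z \<otimes> u" \<tau>]) (use u z' z(1) in \<open>simp_all add: m_assoc\<close>)
  also have "\<Delta> n = \<tau> \<otimes> \<tau> [^] (n - 1)"
    using n_pos nat_pow_Suc2[of \<tau> "n - 1"] by (simp add: Delta_eq_tau_pow)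
  finally have "z \<otimes> u = \<tau> [^] (n - 1)"
    by (rule left_cancel[of \<tau>]) (use z(1) u(1) in simp_all)
  with u(1) show ?thesis by (metis dividesI)
qed

section \<open>Powers of \<open>r n\<close> and the sets \<open>D n i\<close>\<close>

lemma rn_pow_divides_mono:
  fixes j k :: nat
  assumes "r n [^] k divides z" "j \<le> k" "z \<in> carrier G"
  shows "r n [^] j divides z"
proof -
  have "r n [^] k = r n [^] j \<otimes> r n [^] (k - j)"
    using assms(2) by (simp add: nat_pow_mult)
  then have "r n [^] j divides r n [^] k" by (auto intro: dividesI)
  then show ?thesis using assms(1) by (rule divides_trans) simp
qed

lemma rn_pow_divides_imp_le:
  fixes k :: nat
  assumes "r n [^] k divides z"
  shows "k \<le> weight z"
proof -
  have "k \<le> weight (r n [^] k)" for k :: nat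
  proof (induction k)
    case (Suc k)
    have "weight (r n) > 0" using wt_atom n_pos by auto
    with Suc show ?case by (simp add: wt_mult)
  qed simp
  then show ?thesis
    using divides_imp_wt_le[OF assms] le_trans nat_pow_closed rn_closed(1) by blast
qed

text \<open>The exponents form an initial segment bounded by the weight, so the maximum is located
  by the first failure.\<close>

lemma d_eq_iff:
  assumes "z \<in> carrier G"
  shows "d n z = i \<longleftrightarrow> r n [^] i divides z \<and> \<not> r n [^] (i + 1) divides z"
proof -
  let ?K = "{k :: nat. r n [^] k divides z}"
  have d: "d n z = Max ?K" by (simp add: d_def G_def)
  have "?K \<subseteq> {..weight z}" using rn_pow_divides_imp_le by auto
  then have fin: "finite ?K" by (rule finite_subset) simp
  have "0 \<in> ?K" using one_divides[OF assms] by simp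
  then have "Max ?K \<in> ?K" using Max_in[OF fin] by blast
  moreover have "k \<le> Max ?K" if "r n [^] k divides z" for k :: nat
    using Max_ge[OF fin] that by blast
  moreover have "k \<le> i" if "r n [^] k divides z" "\<not> r n [^] (i + 1) divides z" for k :: nat
    using rn_pow_divides_mono[OF that(1) _ assms, of "i + 1"] that(2) by fastforce
  ultimately show ?thesis
    unfolding d by (metis (mono_tags, lifting) antisym mem_Collect_eq not_less_eq_eq order_refl Suc_eq_plus1)
qed

lemma Div_iff: "z \<in> Div\<Delta> n \<longleftrightarrow> z \<in> carrier G \<and> z divides \<Delta> n"
  by (auto simp: Div\<Delta>_def G_def)

lemma D_iff:
  "z \<in> D n i \<longleftrightarrow> z \<in> carrier G \<and> z divides \<Delta> n \<and>
     r n [^] i divides z \<and> \<not> r n [^] (i + 1) divides z"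
  unfolding D_def using d_eq_iff by (auto simp: Div_iff simp del: pow_add_1)

lemma div_poset_eq: "div_poset n X = dvd_poset X"
  by (simp add: div_poset_def G_def)

lemma lcm_closed_Div: "lcm_closed (Div\<Delta> n)"
  unfolding lcm_closed_def
proof (intro ballI allI impI)
  fix a b l assume "a \<in> Div\<Delta> n" "b \<in> Div\<Delta> n" and l: "is_lcm a b l"
  then have "l divides \<Delta> n"
    by (intro is_lcmD(4)[OF l]) (simp_all add: Div_iff)
  with is_lcmD(1)[OF l] show "l \<in> Div\<Delta> n" by (simp add: Div_iff)
qed

lemma rn_pow_divides_cofactor:
  assumes "z \<in> carrier G" "r n [^] i \<otimes> z divides \<Delta> n" "i \<le> n + 1"
  shows "z divides \<Delta> n"
proof -
  have "r n [^] i \<otimes> z divides r n [^] i \<otimes> r n [^] (n + 1 - i)"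
    using assms(2,3) by (simp add: Delta_eq nat_pow_mult del: pow_add_1)
  then have "z divides r n [^] (n + 1 - i)"
    by (rule divides_left_cancel) (use assms(1) in simp_all)
  moreover have "r n [^] (n + 1 - i) divides \<Delta> n"
    unfolding Delta_eq by (rule rn_pow_divides_mono[of "n + 1"]) (simp_all del: pow_add_1)
  ultimately show ?thesis using assms(1) by (rule divides_trans)
qed

text \<open>Remove \<open>r n [^] i\<close> from \<open>z\<close> and apply
  \<open>divides_tau_pow\<close> to the rest, which \<open>r n\<close> does not divide. The bound
  itself need not divide \<open>\<Delta>\<close>; it serves as a common multiple of all of
  \<open>D n i\<close> that is not divisible by \<open>r n [^] (i + 1)\<close>.\<close>

lemma D_divides_rn_pow_tau_pow:
  assumes "z \<in> D n i" "i \<le> n + 1"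
  shows "z divides r n [^] i \<otimes> \<tau> [^] (n - 1)"
proof -
  obtain z' where z': "z' \<in> carrier G" "z = r n [^] i \<otimes> z'"
    using assms(1) by (auto simp: D_iff factor_def)
  have "\<not> r n divides z'"
  proof
    assume "r n divides z'"
    then have "r n [^] i \<otimes> r n divides z"
      unfolding z'(2) by (rule divides_mult_lI) simp_all
    with assms(1) show False by (simp add: D_iff)
  qed
  moreover have "z' divides \<Delta> n"
    using rn_pow_divides_cofactor[of z' i] assms z' by (simp add: D_iff)
  ultimately have "z' divides \<tau> [^] (n - 1)"
    using z'(1) by (intro divides_tau_pow)
  with z' show ?thesis by (simp add: divides_mult_lI)
qed

text \<open>The lcm divides the common bound \<open>r n [^] i \<otimes> \<tau> [^] (n - 1)\<close>,
  so it cannot acquire a further initial factor \<open>r n\<close>.\<close>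

lemma lcm_closed_D:
  assumes "i \<le> n + 1"
  shows "lcm_closed (D n i)"
  unfolding lcm_closed_def
proof (intro ballI allI impI)
  fix a b l assume ab: "a \<in> D n i" "b \<in> D n i" and l: "is_lcm a b l"
  note lD = is_lcmD[OF l]
  have "l divides r n [^] i \<otimes> \<tau> [^] (n - 1)"
    by (rule lD(4)) (use ab assms D_divides_rn_pow_tau_pow in auto)
  moreover have "\<not> r n [^] (i + 1) divides r n [^] i \<otimes> \<tau> [^] (n - 1)"
    using rho_not_divides_tau_pow[of "n - 1" n] divides_left_cancel[of "r n [^] i" "r n" "\<tau> [^] (n - 1)"] n_pos
    by auto
  ultimately have "\<not> r n [^] (i + 1) divides l"
    using divides_trans nat_pow_closed rn_closed(1) by blast
  moreover have "r n [^] i divides l"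
    using ab(1) lD(2) by (auto simp: D_iff intro: divides_trans)
  ultimately show "l \<in> D n i"
    using lD ab by (simp add: D_iff)
qed

lemma rn_pow_in_D:
  assumes "i \<le> n + 1"
  shows "r n [^] i \<in> D n i"
proof -
  have "r n [^] i divides \<Delta> n"
    unfolding Delta_eq by (rule rn_pow_divides_mono[of "n + 1"]) (use assms in \<open>simp_all del: pow_add_1\<close>)
  moreover have "\<not> r n [^] (i + 1) divides r n [^] i"
  proof
    assume "r n [^] (i + 1) divides r n [^] i"
    then have "weight (r n [^] i \<otimes> r n) \<le> weight (r n [^] i)"
      using divides_imp_wt_le by simp
    moreover have "weight (r n) > 0" using wt_atom n_pos by auto
    ultimately show False by (simp add: wt_mult)
  qed
  ultimately show ?thesis by (simp add: D_iff)
qed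

lemma D_subset: "D n i \<subseteq> Div\<Delta> n" "D n i \<subseteq> carrier G" "Div\<Delta> n \<subseteq> carrier G"
  by (auto simp: D_iff Div_iff)

section \<open>The lattices and the formula for the meet\<close>

lemma lattice_Div: "lattice (Div_poset n)"
  unfolding div_poset_eq
proof (rule lcm_closed_lattice)
  show "lcm_closed (Div\<Delta> n)" by (rule lcm_closed_Div)
  show "\<one> \<in> Div\<Delta> n" by (simp add: Div_iff one_divides)
qed (auto simp: Div_iff one_divides intro: Delta_closed)

lemma lattice_D:
  assumes "i \<le> n + 1"
  shows "lattice (D_poset n i)"
  unfolding div_poset_eq
proof (rule lcm_closed_lattice)
  show "lcm_closed (D n i)" using assms by (rule lcm_closed_D)
  show "r n [^] i \<in> D n i" using assms by (rule rn_pow_in_D)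
qed (auto simp: D_iff intro: Delta_closed)

lemma glb_in_Div:
  assumes "y \<in> Div\<Delta> n" "z \<in> Div\<Delta> n"
  obtains g where "is_glb (Div_poset n) g {y, z}"
proof -
  interpret lattice "Div_poset n" by (rule lattice_Div)
  show ?thesis
    using inf_of_two_exists[of y z] assms that by (auto simp: div_poset_def)
qed

text \<open>As \<open>i \<le> j\<close>, the power \<open>r n [^] i\<close> divides both elements
  and hence their meet; the meet divides \<open>y\<close>, so no higher power divides it.\<close>

lemma glb_in_D:
  assumes y: "y \<in> D n i" and z: "z \<in> D n j" and ij: "i \<le> j"
    and g: "is_glb (Div_poset n) g {y, z}"
  shows "g \<in> D n i"
proof -
  have yz: "{y, z} \<subseteq> Div\<Delta> n" using y z D_subset by auto
  have gD: "g \<in> Div\<Delta> n" "g divides y" "g divides z"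
    "\<And>u. \<lbrakk>u \<in> Div\<Delta> n; u divides y; u divides z\<rbrakk> \<Longrightarrow> u divides g"
    using g unfolding div_poset_eq is_glb_dvd_poset[OF yz] by auto
  have "r n [^] i divides z"
    using z ij rn_pow_divides_mono by (auto simp: D_iff)
  moreover have "r n [^] i divides y" using y by (simp add: D_iff)
  moreover from this have "r n [^] i \<in> Div\<Delta> n"
    using y by (auto simp: D_iff Div_iff intro: divides_trans)
  ultimately have "r n [^] i divides g" using gD(4) by blast
  moreover have "\<not> r n [^] (i + 1) divides g"
    using y gD(2) divides_trans nat_pow_closed rn_closed(1) unfolding D_iff by blast
  ultimately show ?thesis using gD(1) by (simp add: D_iff Div_iff)
qed

lemma meet_D:
  assumes "y \<in> D n i" "z \<in> D n i"
  shows "y \<sqinter>\<^bsub>Div_poset n\<^esub> z = y \<sqinter>\<^bsub>D_poset n i\<^esub> z"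
proof -
  have yz: "{y, z} \<subseteq> D n i" "{y, z} \<subseteq> Div\<Delta> n" using assms D_subset(1) by auto
  obtain g where g: "is_glb (Div_poset n) g {y, z}"
    by (rule glb_in_Div[of y z]) (use yz in auto)
  then have "g \<in> D n i" by (rule glb_in_D[of y i z i, rotated -1]) (use assms in auto)
  with g have "is_glb (D_poset n i) g {y, z}"
    unfolding div_poset_eq is_glb_dvd_poset[OF yz(1)] is_glb_dvd_poset[OF yz(2)]
    using D_subset(1) by blast
  then show ?thesis
    using meet_dvd_poset[OF D_subset(3)] meet_dvd_poset[OF D_subset(2)] g
    unfolding div_poset_eq by simp
qed

text \<open>By \<open>glb_in_D\<close> the meet among all divisors lies in \<open>D n i\<close>, so
  it only depends on the divisors of \<open>z\<close> inside \<open>D n i\<close>. The first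
  conclusion certifies that the chosen \<open>\<Squnion>\<close> really is a least upper
  bound.\<close>

lemma sup_divisors_in_D:
  assumes y: "y \<in> D n i" and z: "z \<in> D n j" and ij: "i \<le> j" "j \<le> n + 1"
  shows "is_lub (D_poset n i) (\<Squnion>\<^bsub>D_poset n i\<^esub> {u \<in> D n i. u divides z}) {u \<in> D n i. u divides z}"
    and "y \<sqinter>\<^bsub>Div_poset n\<^esub> z
      = y \<sqinter>\<^bsub>D_poset n i\<^esub> (\<Squnion>\<^bsub>D_poset n i\<^esub> {u \<in> D n i. u divides z})"
proof -
  let ?S = "{u \<in> D n i. u divides z}"
  have sub: "?S \<subseteq> D n i" by auto
  have zG: "z \<in> carrier G" using z by (simp add: D_iff)
  have yz: "{y, z} \<subseteq> Div\<Delta> n" using y z D_subset by auto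
  obtain g where g: "is_glb (Div_poset n) g {y, z}"
    by (rule glb_in_Div[of y z]) (use yz in auto)
  have gi: "g \<in> D n i" using y z ij(1) g by (rule glb_in_D)
  have gD: "g divides y" "g divides z"
    "\<And>u. \<lbrakk>u \<in> Div\<Delta> n; u divides y; u divides z\<rbrakk> \<Longrightarrow> u divides g"
    using g unfolding div_poset_eq is_glb_dvd_poset[OF yz] by auto
  \<comment> \<open>\<open>?S\<close> is closed under lcms, bounded by \<open>z\<close>, and
    nonempty because it contains the meet \<open>g\<close>; its join is therefore one of its
    members.\<close>
  have "\<exists>m\<in>?S. \<forall>u\<in>?S. u divides m"
  proof (rule lcm_closed_greatest)
    show "lcm_closed ?S"
      using ij zG by (intro lcm_closed_divisors lcm_closed_D) auto
    show "?S \<noteq> {}" using gi gD by blast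
  qed (use zG D_subset in auto)
  then obtain m where m: "m \<in> D n i" "m divides z" "\<And>u. \<lbrakk>u \<in> D n i; u divides z\<rbrakk> \<Longrightarrow> u divides m"
    by blast
  have lub: "is_lub (D_poset n i) m ?S"
    unfolding div_poset_eq is_lub_dvd_poset[OF sub] using m by blast
  then have sup: "\<Squnion>\<^bsub>D_poset n i\<^esub> ?S = m"
    unfolding div_poset_eq by (rule sup_dvd_poset[OF D_subset(2)])
  with lub show "is_lub (D_poset n i) (\<Squnion>\<^bsub>D_poset n i\<^esub> ?S) ?S" by simp
  have ym: "{y, m} \<subseteq> D n i" using y m by simp
  \<comment> \<open>A member of \<open>D n i\<close> divides \<open>m\<close> exactly when it
    divides \<open>z\<close>, so replacing \<open>z\<close> by \<open>m\<close> keeps the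
    meet.\<close>
  have "is_glb (D_poset n i) g {y, m}"
    unfolding div_poset_eq is_glb_dvd_poset[OF ym]
  proof (intro conjI ballI impI)
    show "g \<in> D n i" by (rule gi)
    show "g divides v" if "v \<in> {y, m}" for v
      using that gD(1,2) gi m(3) by auto
    fix u assume u: "u \<in> D n i" "\<forall>v\<in>{y, m}. u divides v"
    then have "u divides z" using divides_trans[of u m z] m(2) D_subset(2) by auto
    with u show "u divides g" using gD(3) D_subset(1) by blast
  qed
  then show "y \<sqinter>\<^bsub>Div_poset n\<^esub> z = y \<sqinter>\<^bsub>D_poset n i\<^esub> (\<Squnion>\<^bsub>D_poset n i\<^esub> ?S)"
    using meet_dvd_poset[OF D_subset(3)] meet_dvd_poset[OF D_subset(2)] g sup
    unfolding div_poset_eq by simp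
qed

end

theorem theorem2p8:
  fixes n :: nat
  assumes "n \<ge> 1"
  shows "lattice (Div_poset n) \<and>
    (\<forall>i \<le> n + 1. lattice (D_poset n i)) \<and>
    (\<forall>i \<le> n + 1. \<forall>j \<le> n + 1. i \<le> j \<longrightarrow> (\<forall>x \<in> D n i. \<forall>y \<in> D n j.
       is_lub (D_poset n i) (\<Squnion>\<^bsub>D_poset n i\<^esub> {z \<in> D n i. z divides\<^bsub>M n\<^esub> y})
         {z \<in> D n i. z divides\<^bsub>M n\<^esub> y} \<and>
       x \<sqinter>\<^bsub>Div_poset n\<^esub> y
         = x \<sqinter>\<^bsub>D_poset n i\<^esub> (\<Squnion>\<^bsub>D_poset n i\<^esub> {z \<in> D n i. z divides\<^bsub>M n\<^esub> y}))) \<and>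
    (\<forall>i \<le> n + 1. \<forall>x \<in> D n i. \<forall>y \<in> D n i.
       x \<sqinter>\<^bsub>Div_poset n\<^esub> y = x \<sqinter>\<^bsub>D_poset n i\<^esub> y)"
proof -
  interpret rho_monoid n "M n"
    using assms by unfold_locales simp_all
  show ?thesis
    by (intro conjI allI ballI impI lattice_Div lattice_D sup_divisors_in_D meet_D)
qed

end
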